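(* Let $j^{\operatorname{last}}_{m,k}(231)$ be the number of $231$-avoiding Jacobi permutations $\pi\in\mathfrak{S}_m$ whose last letter equals $k$. For all $n,k\geq1$, \[ j^{\operatorname{last}}_{2n,k}(231)=\sum_{m=0}^{n-1}\frac{n+k-3m-1}{n+k-1}\binom{n-m-1}{k-2m-1}\binom{n+k-1}{m} \] and \[ j^{\operatorname{last}}_{2n+1,k}(231)=\sum_{m=0}^{n-1}\frac{n+k-3m-1}{n+k-1}\binom{n-m}{k-2m-1}\binom{n+k-1}{m}. \]
   Context: A permutation of a finite set $S$ of positive integers is a word in which each element of $S$ appears exactly once; $\mathfrak{S}_m$ is the set of permutations of $\{1,\dots,m\}$. For a permutation $\pi$ and a letter $x$ of $\pi$, $\rho_\pi(x)$ is the maximal consecutive subword of $\pi$ consisting of the letters immediately to the right of $x$ that are all larger than $x$. $\pi$ is Jacobi if $|\rho_\pi(x)|$ is even for all letters $x$. A permutation $\pi$ avoids a pattern $\sigma$ if no subword of $\pi$ has standardization (relative order) $\sigma$. Binomial coefficients $\binom{a}{b}$ are $0$ when $b<0$ or $b>a$. *)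

theory Defs
  imports Complex_Main "HOL-Combinatorics.Multiset_Permutations" "HOL-Library.Sublist"
begin

text \<open>A permutation of a finite set \<open>S\<close> of positive integers is a word, i.e. an element of
  \<open>permutations_of_set S\<close>.\<close>

definition rho :: "nat list \<Rightarrow> nat \<Rightarrow> nat list" where
  "rho \<pi> x = takeWhile (\<lambda>y. x < y) (tl (dropWhile (\<lambda>y. y \<noteq> x) \<pi>))"

definition jacobi :: "nat list \<Rightarrow> bool" where
  "jacobi \<pi> \<longleftrightarrow> (\<forall>x\<in>set \<pi>. even (length (rho \<pi> x)))"

definition standardization :: "nat list \<Rightarrow> nat list" where
  "standardization w = map (\<lambda>x. card {y \<in> set w. y \<le> x}) w"

text \<open>Subwords in pattern avoidance need not be consecutive.\<close>

definition avoids :: "nat list \<Rightarrow> nat list \<Rightarrow> bool" where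
  "avoids \<pi> \<sigma> \<longleftrightarrow> \<not> (\<exists>w. subseq w \<pi> \<and> standardization w = \<sigma>)"

definition jlast :: "nat list \<Rightarrow> nat \<Rightarrow> nat \<Rightarrow> nat" where
  "jlast \<sigma> m k =
     card {\<pi> \<in> permutations_of_set {1..m}.
             jacobi \<pi> \<and> avoids \<pi> \<sigma> \<and> \<pi> \<noteq> [] \<and> last \<pi> = k}"

text \<open>The lower index of a binomial coefficient may be negative, so truncated subtraction on
  \<open>nat\<close> must be avoided.\<close>

definition int_binomial :: "int \<Rightarrow> int \<Rightarrow> nat" where
  "int_binomial a b = (if b < 0 \<or> b > a then 0 else nat a choose nat b)"

end

theory Submission
  imports Defs "HOL-Computational_Algebra.Polynomial" "HOL-Computational_Algebra.Formal_Power_Series"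
begin

text \<open>
  A \<open>231\<close>-avoiding word on \<open>{1..m}\<close> with first letter \<open>f\<close> has the form \<open>f # u @ v\<close>, where \<open>u\<close>
  consists of the letters below \<open>f\<close> and \<open>v\<close> of those above. The run \<open>rho\<close> of the last letter
  of \<open>u\<close> (or of \<open>f\<close>, if \<open>u\<close> is empty) is all of \<open>v\<close>, so the word is Jacobi iff \<open>u\<close> and \<open>v\<close>
  are Jacobi and \<open>v\<close> has even length. Let \<open>x\<close> mark half the length (rounded down) and \<open>t\<close> the last
  letter, and let \<open>e\<close> be the generating function of the words of even length, taken at \<open>x t\<^sup>2\<close>.
  Then \<open>e = 1 + x t\<^sup>2 e\<^sup>3\<close>, and the series \<open>P\<close> and \<open>Q\<close> for even and odd length satisfy
  \<open>P = x e Q\<close> and \<open>Q = t + x e (1 + t e) Q\<close>. The formulas follow by expanding the geometric series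
  for \<open>Q\<close>, the powers of \<open>1 + t e\<close>, and the powers of \<open>e\<close>, whose coefficients are Raney numbers.
\<close>

section \<open>Decomposition by the first letter\<close>

lemma standardization_eq_231_iff:
  "standardization w = [2,3,1] \<longleftrightarrow> (\<exists>a b c. w = [a,b,c] \<and> c < a \<and> a < b)"
proof
  assume st: "standardization w = [2,3,1]"
  then have len: "length w = 3"
    unfolding standardization_def by (auto dest: arg_cong[of _ _ length])
  then obtain a b c where w: "w = [a,b,c]"
    by (auto simp: numeral_3_eq_3 length_Suc_conv)
  have A: "card {y \<in> set w. y \<le> a} = 2" and B: "card {y \<in> set w. y \<le> b} = 3"
    and C: "card {y \<in> set w. y \<le> c} = 1"
    using st w by (auto simp: standardization_def)
  \<comment> \<open>The rank of a letter is monotone in the letter, so a strict inequality of ranks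
    reflects to the letters.\<close>
  have mono: "x < y" if "card {z \<in> set w. z \<le> x} < card {z \<in> set w. z \<le> y}" for x y
  proof (rule ccontr)
    assume "\<not> x < y"
    then have "{z \<in> set w. z \<le> y} \<subseteq> {z \<in> set w. z \<le> x}" by auto
    then have "card {z \<in> set w. z \<le> y} \<le> card {z \<in> set w. z \<le> x}"
      by (intro card_mono) auto
    with that show False by simp
  qed
  from mono[of c a] mono[of a b] A B C w
  show "\<exists>a b c. w = [a,b,c] \<and> c < a \<and> a < b" by auto
next
  assume "\<exists>a b c. w = [a,b,c] \<and> c < a \<and> a < b"
  then obtain a b c where w: "w = [a,b,c]" "c < a" "a < b" by blast
  have "{y \<in> {a,b,c}. y \<le> a} = {a,c}" "{y \<in> {a,b,c}. y \<le> b} = {a,b,c}"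
    "{y \<in> {a,b,c}. y \<le> c} = {c}" using w by auto
  then show "standardization w = [2,3,1]"
    using w by (simp add: standardization_def)
qed

text \<open>A form free of \<open>standardization\<close>, suited to recursion on the first
  letter.\<close>

definition avoids_231 :: "nat list \<Rightarrow> bool" where
  "avoids_231 w \<longleftrightarrow> (\<forall>a b c. subseq [a,b,c] w \<longrightarrow> \<not> (c < a \<and> a < b))"

lemma avoids_iff_avoids_231: "avoids w [2,3,1] \<longleftrightarrow> avoids_231 w"
  unfolding avoids_def standardization_eq_231_iff avoids_231_def by blast

text \<open>An occurrence that uses the head has it in the role of 2; every other occurrence lies in
  \<open>w\<close>.\<close>

lemma avoids_231_Cons_iff:
  "avoids_231 (f # w) \<longleftrightarrow>
     avoids_231 w \<and> (\<forall>b c. subseq [b,c] w \<longrightarrow> \<not> (c < f \<and> f < b))"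
proof -
  have *: "subseq [a,b,c] (f # w) \<longleftrightarrow> (a = f \<and> subseq [b,c] w) \<or> subseq [a,b,c] w" for a b c
    using subseq_Cons'[of a "[b,c]" w] by (cases "a = f") auto
  show ?thesis unfolding avoids_231_def * by metis
qed

lemma avoids_231_subseq:
  assumes "avoids_231 w" "subseq v w"
  shows "avoids_231 v"
  using assms subseq_order.order_trans unfolding avoids_231_def by blast

lemma subseq_imp_set_subset: "subseq v w \<Longrightarrow> set v \<subseteq> set w"
  by (auto simp: subseq_conv_nths dest: in_set_nthsD)

lemma subseq_pair_imp_mem:
  assumes "subseq [b,c] w"
  shows "b \<in> set w" "c \<in> set w"
  using subseq_imp_set_subset[OF assms] by auto

lemma subseq_pair_append_iff:
  "subseq [b,c] (u @ v) \<longleftrightarrow>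
     subseq [b,c] u \<or> (b \<in> set u \<and> c \<in> set v) \<or> subseq [b,c] v"
proof -
  have split: "[b,c] = xs @ ys \<longleftrightarrow>
      xs = [] \<and> ys = [b,c] \<or> xs = [b] \<and> ys = [c] \<or> xs = [b,c] \<and> ys = []" for xs ys
    by (auto simp: Cons_eq_append_conv)
  have "subseq [b,c] (u @ v) \<longleftrightarrow> (\<exists>xs ys. [b,c] = xs @ ys \<and> subseq xs u \<and> subseq ys v)"
    by (rule subseq_append_iff)
  also have "\<dots> \<longleftrightarrow> subseq [b,c] u \<or> (subseq [b] u \<and> subseq [c] v) \<or> subseq [b,c] v"
    unfolding split by (simp only: conj_disj_distribR ex_disj_distrib simp_thms list_emb_Nil) auto
  finally show ?thesis by (simp only: subseq_singleton_left)
qed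

text \<open>An occurrence straddling the boundary would end in \<open>v\<close>, above its first
  letter from \<open>u\<close>, whereas 231 ends with its smallest letter.\<close>

lemma avoids_231_append:
  assumes "avoids_231 u" "avoids_231 v" "\<And>x y. x \<in> set u \<Longrightarrow> y \<in> set v \<Longrightarrow> x < y"
  shows "avoids_231 (u @ v)"
  using assms
proof (induction u)
  case (Cons f u)
  have av: "avoids_231 (u @ v)"
    using Cons by (auto simp: avoids_231_Cons_iff)
  have "\<not> (c < f \<and> f < b)" if "subseq [b,c] (u @ v)" for b c
  proof -
    have "\<not> (c < f \<and> f < b)" if "subseq [b,c] u" using that Cons.prems(1) by (auto simp: avoids_231_Cons_iff)
    moreover have "f < c" if "c \<in> set v" using that Cons.prems(3) by auto
    ultimately show ?thesis
      using that subseq_pair_imp_mem[of b c v] by (auto simp: subseq_pair_append_iff)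
  qed
  with av show ?case by (auto simp: avoids_231_Cons_iff)
qed simp

lemma avoids_231_map_add_iff:
  "avoids_231 (map (\<lambda>x. x + d) w) \<longleftrightarrow> avoids_231 w"
proof
  assume L: "avoids_231 (map (\<lambda>x. x + d) w)"
  show "avoids_231 w" unfolding avoids_231_def
  proof (intro allI impI)
    fix a b c assume "subseq [a,b,c] w"
    then have "subseq (map (\<lambda>x. x + d) [a,b,c]) (map (\<lambda>x. x + d) w)" by (rule subseq_map)
    then have "subseq [a + d, b + d, c + d] (map (\<lambda>x. x + d) w)" by simp
    then have "\<not> (c + d < a + d \<and> a + d < b + d)"
      using L unfolding avoids_231_def by blast
    then show "\<not> (c < a \<and> a < b)" by simp
  qed
next
  assume R: "avoids_231 w"
  show "avoids_231 (map (\<lambda>x. x + d) w)" unfolding avoids_231_def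
  proof (intro allI impI)
    fix a b c assume sub: "subseq [a,b,c] (map (\<lambda>x. x + d) w)"
    \<comment> \<open>All letters are at least \<open>d\<close>, so the truncated subtraction below
      undoes the shift and reflects the order.\<close>
    then have ge: "a \<ge> d" "b \<ge> d" "c \<ge> d" using subseq_imp_set_subset[OF sub] by auto
    from sub have "subseq (map (\<lambda>x. x - d) [a,b,c]) (map (\<lambda>x. x - d) (map (\<lambda>x. x + d) w))"
      by (rule subseq_map)
    then have "subseq [a - d, b - d, c - d] w" by (simp add: comp_def)
    then have "\<not> (c - d < a - d \<and> a - d < b - d)" using R unfolding avoids_231_def by blast
    then show "\<not> (c < a \<and> a < b)" using ge by linarith
  qed
qed

section \<open>Runs and the Jacobi condition under concatenation\<close>

lemma rho_Cons: "rho (f # w) x = (if x = f then takeWhile (\<lambda>y. x < y) w else rho w x)"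
  by (auto simp: rho_def)

lemma rho_append_right:
  assumes "x \<notin> set u"
  shows "rho (u @ v) x = rho v x"
  using assms by (induction u) (auto simp: rho_Cons)

lemma takeWhile_append_above:
  fixes x :: nat
  assumes "\<And>y. y \<in> set v \<Longrightarrow> x < y"
  shows "length (takeWhile (\<lambda>y. x < y) (u @ v)) =
    length (takeWhile (\<lambda>y. x < y) u) + (if \<forall>y\<in>set u. x < y then length v else 0)"
  using assms by (induction u) (auto simp: takeWhile_eq_all_conv[THEN iffD2])

text \<open>The run of \<open>x\<close> either stops inside \<open>u\<close> or reaches the end of
  \<open>u\<close> and then takes in all of \<open>v\<close>; its length grows by 0 or by the even
  number \<open>length v\<close>.\<close>

lemma even_length_rho_append_left:
  assumes "x \<in> set u" "even (length v)" "\<And>y. y \<in> set v \<Longrightarrow> x < y"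
  shows "even (length (rho (u @ v) x)) \<longleftrightarrow> even (length (rho u x))"
  using assms(1)
proof (induction u)
  case (Cons f u)
  show ?case
  proof (cases "x = f")
    case True
    then show ?thesis using takeWhile_append_above[of v x u] assms(2,3) by (simp add: rho_Cons)
  next
    case False
    with Cons show ?thesis by (simp add: rho_Cons)
  qed
qed simp

lemma rho_map_add: "rho (map (\<lambda>x. x + d) w) (x + d) = map (\<lambda>x. x + d) (rho w x)"
  by (induction w) (auto simp: rho_Cons takeWhile_map comp_def, simp add: rho_def)

lemma jacobi_map_add_iff: "jacobi (map (\<lambda>x. x + d) w) \<longleftrightarrow> jacobi w"
  unfolding jacobi_def by (simp add: rho_map_add)

text \<open>All of \<open>v\<close> is the run of the letter just before it, which is
  \<open>f\<close> or the last letter of \<open>u\<close>; this forces \<open>v\<close> to be even.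
  Given that, the runs of letters of \<open>u\<close> keep their parity, those of letters of
  \<open>v\<close> are unchanged, and the run of \<open>f\<close> is \<open>v\<close> or
  empty.\<close>

lemma jacobi_Cons_append_iff:
  assumes dist: "distinct (f # u @ v)"
    and below: "\<And>x. x \<in> set u \<Longrightarrow> x < f" and above: "\<And>y. y \<in> set v \<Longrightarrow> f < y"
  shows "jacobi (f # u @ v) \<longleftrightarrow> even (length v) \<and> jacobi u \<and> jacobi v"
proof -
  have lt: "x < y" if "x \<in> set u" "y \<in> set v" for x y
    using below[OF that(1)] above[OF that(2)] by simp
  have rest: "jacobi (f # u @ v) \<longleftrightarrow> jacobi u \<and> jacobi v" if ev: "even (length v)"
  proof -
    have "rho (f # u @ v) f = (if u = [] then v else [])"
      using below above by (cases u) (auto simp: rho_Cons takeWhile_eq_all_conv[THEN iffD2] order_less_imp_not_less)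
    then have F: "even (length (rho (f # u @ v) f))" using ev by simp
    have U: "even (length (rho (f # u @ v) x)) \<longleftrightarrow> even (length (rho u x))" if "x \<in> set u" for x
      using that below[OF that] even_length_rho_append_left[OF that ev] lt[OF that]
      by (auto simp: rho_Cons)
    have V: "rho (f # u @ v) x = rho v x" if "x \<in> set v" for x
      using that dist above[OF that] rho_append_right[of x u v] by (auto simp: rho_Cons)
    show ?thesis unfolding jacobi_def using F U V by (simp add: ball_Un)
  qed
  have "even (length v)" if J: "jacobi (f # u @ v)"
  proof (cases u rule: rev_cases)
    case Nil
    then have "rho (f # u @ v) f = v"
      using above by (auto simp: rho_Cons takeWhile_eq_all_conv[THEN iffD2])
    then show ?thesis using J by (force simp: jacobi_def)
  next
    case (snoc u' l)
    have "l \<in> set u" using snoc by simp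
    have "rho (f # u @ v) l = rho ((f # u') @ (l # v)) l" using snoc by simp
    also have "\<dots> = rho (l # v) l"
      using dist snoc by (intro rho_append_right) auto
    also have "\<dots> = v"
      using lt[OF \<open>l \<in> set u\<close>] by (auto simp: rho_Cons takeWhile_eq_all_conv[THEN iffD2])
    finally show ?thesis using J snoc by (force simp: jacobi_def)
  qed
  with rest show ?thesis by blast
qed

section \<open>The bijection with pairs of smaller words\<close>

definition jacobi_231 :: "nat \<Rightarrow> nat list set" where
  "jacobi_231 m = {\<pi> \<in> permutations_of_set {1..m}. jacobi \<pi> \<and> avoids_231 \<pi>}"

lemma finite_jacobi_231 [simp]: "finite (jacobi_231 m)"
  unfolding jacobi_231_def by (rule finite_subset[of _ "permutations_of_set {1..m}"]) auto

lemma jacobi_231_0: "jacobi_231 0 = {[]}"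
  by (auto simp: jacobi_231_def jacobi_def avoids_231_def)

lemma jacobi_231_length: "w \<in> jacobi_231 m \<Longrightarrow> length w = m"
  by (auto simp: jacobi_231_def dest: length_finite_permutations_of_set)

text \<open>The right factor is kept as a word on \<open>{1..m - f}\<close> and shifted here, so
  that both factors come from the family \<open>jacobi_231\<close>.\<close>

definition glue :: "nat \<Rightarrow> nat list \<Rightarrow> nat list \<Rightarrow> nat list" where
  "glue f u v = f # u @ map (\<lambda>x. x + f) v"

lemma image_add_atLeastAtMost_1: "(\<lambda>x. x + f) ` {1..m} = {f<..f + m}" for f m :: nat
proof -
  have "(\<lambda>x. x + f) ` {1..m} = {1 + f..m + f}" by (rule image_add_atLeastAtMost')
  then show ?thesis by auto
qed

lemma glue_mem_jacobi_231:
  assumes "f \<in> {1..m}" "even (m - f)" "u \<in> jacobi_231 (f - 1)" "v \<in> jacobi_231 (m - f)"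
  shows "glue f u v \<in> jacobi_231 m"
proof -
  let ?v = "map (\<lambda>x. x + f) v"
  have u: "set u = {1..f - 1}" "distinct u" "jacobi u" "avoids_231 u"
    and v: "set v = {1..m - f}" "distinct v" "jacobi v" "avoids_231 v"
    using assms(3,4) by (auto simp: jacobi_231_def permutations_of_set_def)
  have setv: "set ?v = {f<..m}"
    using assms(1) image_add_atLeastAtMost_1[of f "m - f"] v(1) by simp
  have dist: "distinct (f # u @ ?v)"
  proof -
    have "f \<notin> set u" "f \<notin> set ?v" "set u \<inter> set ?v = {}" using u(1) setv assms(1) by auto
    moreover have "distinct ?v" using v(2) by (simp add: distinct_map inj_on_def)
    ultimately show ?thesis using u(2) by simp
  qed
  have "insert f ({1..f - 1} \<union> {f<..m}) = {1..m}" using assms(1) by auto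
  then have set: "set (f # u @ ?v) = {1..m}" using u(1) setv by simp
  have lt: "x < f" if "x \<in> set u" for x using that u(1) assms(1) by auto
  have gt: "f < x" if "x \<in> set ?v" for x using that setv by auto
  have "jacobi (f # u @ ?v)"
    using jacobi_Cons_append_iff[OF dist lt gt] u v assms(2) jacobi_231_length[OF assms(4)]
    by (simp add: jacobi_map_add_iff)
  moreover have "avoids_231 (f # u @ ?v)"
  proof -
    have "avoids_231 (u @ ?v)"
    proof (rule avoids_231_append)
      show "x < y" if "x \<in> set u" "y \<in> set ?v" for x y
        using lt[OF that(1)] gt[OF that(2)] by simp
    qed (use u v in \<open>simp_all add: avoids_231_map_add_iff\<close>)
    \<comment> \<open>With \<open>f\<close> in the role of 2, a letter above \<open>f\<close> would
      have to precede one below \<open>f\<close>, but the letters of \<open>u\<close> come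
      first.\<close>
    moreover have "\<not> (c < f \<and> f < b)" if "subseq [b,c] (u @ ?v)" for b c
    proof -
      have "b \<in> set u \<or> c \<in> set ?v"
        using that subseq_pair_imp_mem(1)[of b c u] subseq_pair_imp_mem(2)[of b c ?v]
        unfolding subseq_pair_append_iff by argo
      then show ?thesis using lt[of b] gt[of c] by linarith
    qed
    ultimately show ?thesis by (simp add: avoids_231_Cons_iff)
  qed
  ultimately show ?thesis
    using dist set by (simp add: jacobi_231_def permutations_of_set_def glue_def)
qed

text \<open>The tail is cut at its first letter above \<open>f\<close>. A letter below
  \<open>f\<close> after the cut would complete a 231 with \<open>f\<close> and that letter, so the
  two sides hold exactly the letters below and above \<open>f\<close>.\<close>

lemma jacobi_231_cases:
  assumes "w \<in> jacobi_231 m" "m \<ge> 1"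
  obtains f u v where "w = glue f u v" "f \<in> {1..m}" "even (m - f)"
    "u \<in> jacobi_231 (f - 1)" "v \<in> jacobi_231 (m - f)"
proof -
  have w: "set w = {1..m}" "distinct w" "jacobi w" "avoids_231 w"
    using assms(1) by (auto simp: jacobi_231_def permutations_of_set_def)
  then obtain f r where r: "w = f # r" using assms(2) by (cases w) auto
  define u where "u = takeWhile (\<lambda>x. x < f) r"
  define v where "v = dropWhile (\<lambda>x. x < f) r"
  have wuv: "w = f # u @ v" by (simp add: r u_def v_def)
  have lt: "x < f" if "x \<in> set u" for x using that unfolding u_def by (auto dest: set_takeWhileD)
  have gt: "f < x" if x: "x \<in> set v" for x
  proof -
    obtain b v' where b: "v = b # v'" using x by (cases v) auto
    have "\<not> b < f" using b unfolding v_def by (simp add: dropWhile_eq_Cons_conv)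
    moreover have "b \<noteq> f" "x \<noteq> f" using w(2) wuv b x by auto
    moreover have "\<not> x < f" if "x \<in> set v'" "f < b"
    proof -
      have "subseq [b,x] v" using that(1) b by (simp add: subseq_singleton_left)
      then have "subseq [b,x] (u @ v)" by (simp add: subseq_pair_append_iff)
      then show ?thesis using w(4) that(2) unfolding wuv avoids_231_Cons_iff by blast
    qed
    ultimately show ?thesis using x b by auto
  qed
  have f: "f \<in> {1..m}" using w(1) wuv by auto
  have all: "insert f (set u \<union> set v) = {1..m}" using w(1) wuv by simp
  have setu: "set u = {1..f - 1}"
  proof
    show "set u \<subseteq> {1..f - 1}" using all lt by fastforce
    show "{1..f - 1} \<subseteq> set u"
    proof
      fix x assume x: "x \<in> {1..f - 1}"
      then have "x \<in> insert f (set u \<union> set v)" unfolding all using f by auto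
      with x gt[of x] show "x \<in> set u" by auto
    qed
  qed
  have setv: "set v = {f<..m}"
  proof
    show "set v \<subseteq> {f<..m}" using all gt by fastforce
    show "{f<..m} \<subseteq> set v"
    proof
      fix x assume x: "x \<in> {f<..m}"
      then have "x \<in> insert f (set u \<union> set v)" unfolding all using f by auto
      with x lt[of x] show "x \<in> set v" by auto
    qed
  qed
  define v0 where "v0 = map (\<lambda>x. x - f) v"
  have v_v0: "v = map (\<lambda>x. x + f) v0"
    unfolding v0_def map_map comp_def using gt by (intro map_idI[symmetric]) (simp add: less_imp_le)
  have "(\<lambda>x. x + f) ` set v0 = (\<lambda>x. x + f) ` {1..m - f}"
    using setv v_v0 f image_add_atLeastAtMost_1[of f "m - f"] by simp
  then have setv0: "set v0 = {1..m - f}"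
    by (rule inj_image_eq_iff[THEN iffD1, rotated]) simp
  have J: "even (length v)" "jacobi u" "jacobi v"
    using jacobi_Cons_append_iff[of f u v] w(2,3) wuv lt gt by auto
  have dist: "distinct u" "distinct v0"
    using w(2) wuv v_v0 by (auto simp: distinct_map)
  have av: "avoids_231 u" "avoids_231 v"
    using w(4) avoids_231_subseq[of w u] avoids_231_subseq[of w v] unfolding wuv
    by (simp_all add: list_emb_Cons subseq_drop_many subseq_rev_drop_many)
  have "u \<in> jacobi_231 (f - 1)"
    using setu dist J av by (simp add: jacobi_231_def permutations_of_set_def)
  moreover have v0: "v0 \<in> jacobi_231 (m - f)"
    using setv0 dist J av v_v0 by (simp add: jacobi_231_def permutations_of_set_def
      jacobi_map_add_iff avoids_231_map_add_iff)
  moreover have "even (m - f)" using J(1) v_v0 jacobi_231_length[OF v0] by simp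
  ultimately show ?thesis using that[of f u v0] wuv v_v0 f by (simp add: glue_def)
qed

text \<open>The weight \<open>g\<close> is arbitrary so that one bijection serves both the plain
  count and the distribution of the last letter.\<close>

lemma sum_jacobi_231:
  fixes g :: "nat list \<Rightarrow> 'a :: comm_monoid_add"
  assumes "m \<ge> 1"
  shows "(\<Sum>w\<in>jacobi_231 m. g w) =
    (\<Sum>f | f \<in> {1..m} \<and> even (m - f).
       \<Sum>u\<in>jacobi_231 (f - 1). \<Sum>v\<in>jacobi_231 (m - f). g (glue f u v))"
proof -
  let ?F = "{f. f \<in> {1..m} \<and> even (m - f)}"
  let ?S = "SIGMA f:?F. jacobi_231 (f - 1) \<times> jacobi_231 (m - f)"
  have "bij_betw (\<lambda>(f,u,v). glue f u v) ?S (jacobi_231 m)"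
    unfolding bij_betw_def
  proof
    show "inj_on (\<lambda>(f,u,v). glue f u v) ?S"
    proof (rule inj_onI)
      fix p p'
      assume p: "p \<in> ?S" "p' \<in> ?S"
        and eq': "(\<lambda>(f,u,v). glue f u v) p = (\<lambda>(f,u,v). glue f u v) p'"
      obtain f u v where pp1: "p = (f,u,v)" by (rule prod_cases3)
      obtain f' u' v' where pp2: "p' = (f',u',v')" by (rule prod_cases3)
      note pp = pp1 pp2
      have eq: "glue f u v = glue f' u' v'" using eq' pp by simp
      have m: "u \<in> jacobi_231 (f - 1)" "u' \<in> jacobi_231 (f' - 1)" using p pp by auto
      have ff: "f = f'" using eq by (simp add: glue_def)
      \<comment> \<open>Both lengths are \<open>f - 1\<close>: the head determines where
        \<open>u\<close> ends.\<close>
      then have "length u = length u'" using m jacobi_231_length by metis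
      then have "u = u'" "map (\<lambda>x. x + f) v = map (\<lambda>x. x + f) v'"
        using eq ff by (auto simp: glue_def)
      moreover have "inj (\<lambda>x. x + f)" by simp
      ultimately show "p = p'"
        using ff pp by (simp add: inj_map_eq_map)
    qed
    show "(\<lambda>(f,u,v). glue f u v) ` ?S = jacobi_231 m"
    proof
      show "(\<lambda>(f,u,v). glue f u v) ` ?S \<subseteq> jacobi_231 m"
        by (auto intro!: glue_mem_jacobi_231)
      show "jacobi_231 m \<subseteq> (\<lambda>(f,u,v). glue f u v) ` ?S"
      proof
        fix w assume "w \<in> jacobi_231 m"
        then obtain f u v where *: "w = glue f u v" "f \<in> {1..m}" "even (m - f)"
          "u \<in> jacobi_231 (f - 1)" "v \<in> jacobi_231 (m - f)"
          using assms by (rule jacobi_231_cases)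
        then show "w \<in> (\<lambda>(f,u,v). glue f u v) ` ?S"
          by (intro image_eqI[of _ _ "(f,u,v)"]) auto
      qed
    qed
  qed
  from sum.reindex_bij_betw[OF this, of g]
  have "(\<Sum>w\<in>jacobi_231 m. g w) = (\<Sum>(f,u,v)\<in>?S. g (glue f u v))"
    by (simp add: case_prod_unfold)
  also have "\<dots> = (\<Sum>f\<in>?F. \<Sum>(u,v)\<in>jacobi_231 (f - 1) \<times> jacobi_231 (m - f). g (glue f u v))"
    by (rule sum.Sigma[symmetric]) auto
  also have "\<dots> = (\<Sum>f\<in>?F. \<Sum>u\<in>jacobi_231 (f - 1). \<Sum>v\<in>jacobi_231 (m - f). g (glue f u v))"
    by (simp add: sum.cartesian_product)
  finally show ?thesis .
qed

section \<open>Recurrences\<close>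

definition count_jacobi_231 :: "nat \<Rightarrow> real" where
  "count_jacobi_231 m = real (card (jacobi_231 m))"

text \<open>The polynomial variable is the \<open>t\<close> that marks the last letter; weight 0 for
  the empty word matches its exclusion from \<open>jlast\<close>.\<close>

definition last_weight :: "nat list \<Rightarrow> real poly" where
  "last_weight w = (if w = [] then 0 else monom 1 (last w))"

definition last_poly :: "nat \<Rightarrow> real poly" where
  "last_poly m = (\<Sum>w\<in>jacobi_231 m. last_weight w)"

lemma coeff_last_poly: "coeff (last_poly m) k = real (jlast [2,3,1] m k)"
proof -
  have "coeff (last_poly m) k = (\<Sum>w\<in>jacobi_231 m. if w \<noteq> [] \<and> last w = k then 1 else 0)"
    unfolding last_poly_def coeff_sum by (intro sum.cong) (auto simp: last_weight_def)
  also have "\<dots> = real (card (jacobi_231 m \<inter> {w. w \<noteq> [] \<and> last w = k}))"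
    by (simp add: sum.If_cases)
  also have "jacobi_231 m \<inter> {w. w \<noteq> [] \<and> last w = k} =
      {\<pi> \<in> permutations_of_set {1..m}. jacobi \<pi> \<and> avoids \<pi> [2,3,1] \<and> \<pi> \<noteq> [] \<and> last \<pi> = k}"
    unfolding jacobi_231_def avoids_iff_avoids_231 by blast
  finally show ?thesis by (simp only: jlast_def)
qed

lemma count_jacobi_231_0: "count_jacobi_231 0 = 1"
  by (simp add: count_jacobi_231_def jacobi_231_0)

lemma last_poly_0: "last_poly 0 = 0"
  by (simp add: last_poly_def jacobi_231_0 last_weight_def)

lemma count_jacobi_231_rec:
  assumes "m \<ge> 1"
  shows "count_jacobi_231 m =
    (\<Sum>f | f \<in> {1..m} \<and> even (m - f). count_jacobi_231 (f - 1) * count_jacobi_231 (m - f))"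
  using sum_jacobi_231[OF assms, of "\<lambda>_. 1 :: real"] by (simp add: count_jacobi_231_def)

text \<open>Shifting \<open>v\<close> by \<open>f\<close> becomes multiplication by
  \<open>monom 1 f\<close>. For empty \<open>v\<close> that product is 0, and the last letter comes
  from \<open>f # u\<close>.\<close>

lemma last_weight_glue:
  "last_weight (glue f u v) = monom 1 f * last_weight v +
     (if v = [] then if u = [] then monom 1 f else last_weight u else 0)"
  by (auto simp: last_weight_def glue_def last_map mult_monom add.commute)

text \<open>The right factor is empty only for \<open>f = m\<close>. In that case nonempty
  \<open>u\<close> contribute \<open>last_poly (m - 1)\<close>, and empty \<open>u\<close> occurs
  only for \<open>m = 1\<close>.\<close>

lemma last_poly_rec:
  assumes "m \<ge> 1"
  shows "last_poly m = (if m = 1 then monom 1 1 else 0) + last_poly (m - 1) +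
    (\<Sum>f | f \<in> {1..m} \<and> even (m - f). monom (count_jacobi_231 (f - 1)) f * last_poly (m - f))"
proof -
  let ?F = "{f. f \<in> {1..m} \<and> even (m - f)}"
  let ?r = "\<lambda>f u v. if v = [] then if u = [] then monom 1 f else last_weight u else (0 :: real poly)"
  have main: "(\<Sum>u\<in>jacobi_231 (f - 1). \<Sum>v\<in>jacobi_231 (m - f). monom 1 f * last_weight v) =
      monom (count_jacobi_231 (f - 1)) f * last_poly (m - f)" for f
  proof -
    have "monom (count_jacobi_231 (f - 1)) f = of_nat (card (jacobi_231 (f - 1))) * monom 1 f"
      by (simp add: count_jacobi_231_def of_nat_monom mult_monom)
    then show ?thesis
      by (simp add: last_poly_def sum_distrib_left mult.assoc)
  qed
  have rest: "(\<Sum>f\<in>?F. \<Sum>u\<in>jacobi_231 (f - 1). \<Sum>v\<in>jacobi_231 (m - f). ?r f u v) =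
      (if m = 1 then monom 1 1 else 0) + last_poly (m - 1)"
  proof -
    have zero: "(\<Sum>u\<in>jacobi_231 (f - 1). \<Sum>v\<in>jacobi_231 (m - f). ?r f u v) = 0" if "f \<in> ?F - {m}" for f
    proof -
      have "v \<noteq> []" if "v \<in> jacobi_231 (m - f)" for v
        using jacobi_231_length[OF that] \<open>f \<in> ?F - {m}\<close> by auto
      then show ?thesis by (intro sum.neutral ballI) simp
    qed
    have "(\<Sum>f\<in>?F. \<Sum>u\<in>jacobi_231 (f - 1). \<Sum>v\<in>jacobi_231 (m - f). ?r f u v) =
        (\<Sum>f\<in>{m}. \<Sum>u\<in>jacobi_231 (f - 1). \<Sum>v\<in>jacobi_231 (m - f). ?r f u v)"
      using assms zero by (intro sum.mono_neutral_right) auto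
    also have "\<dots> = (\<Sum>u\<in>jacobi_231 (m - 1). if u = [] then monom 1 m else last_weight u)"
      by (simp add: jacobi_231_0)
    also have "\<dots> = (if m = 1 then monom 1 1 else 0) + last_poly (m - 1)"
    proof (cases "m = 1")
      case True
      then show ?thesis by (simp add: jacobi_231_0 last_poly_0)
    next
      case False
      then have "u \<noteq> []" if "u \<in> jacobi_231 (m - 1)" for u
        using jacobi_231_length[OF that] assms by auto
      then show ?thesis using False by (simp add: last_poly_def cong: sum.cong)
    qed
    finally show ?thesis .
  qed
  show ?thesis
    unfolding last_poly_def[of m] sum_jacobi_231[OF assms] last_weight_glue sum.distrib main rest
    by (rule add.commute)
qed

section \<open>Recurrences separated by parity\<close>

lemma sum_same_parity_odd:
  fixes g :: "nat \<Rightarrow> nat \<Rightarrow> 'a :: comm_monoid_add"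
  shows "(\<Sum>f | f \<in> {1..2 * n + 1} \<and> even (2 * n + 1 - f). g f (2 * n + 1 - f)) =
    (\<Sum>i=0..n. g (2 * i + 1) (2 * (n - i)))"
  by (rule sum.reindex_bij_witness[of _ "\<lambda>i. 2 * i + 1" "\<lambda>f. f div 2"])
    (auto elim!: evenE oddE simp: algebra_simps)

lemma sum_same_parity_even:
  fixes g :: "nat \<Rightarrow> nat \<Rightarrow> 'a :: comm_monoid_add"
  shows "(\<Sum>f | f \<in> {1..2 * n + 2} \<and> even (2 * n + 2 - f). g f (2 * n + 2 - f)) =
    (\<Sum>i=0..n. g (2 * i + 2) (2 * (n - i)))"
proof -
  \<comment> \<open>This cancels the truncated subtraction in the inverse witness
    \<open>f div 2 - 1\<close>, where \<open>f = 2 * b\<close> with \<open>b\<close>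
    positive.\<close>
  have "Suc (Suc (b * 2 - Suc (Suc 0))) = b * 2" if "Suc 0 \<le> b" for b
    using that by (cases b) auto
  then show ?thesis
    by (intro sum.reindex_bij_witness[of _ "\<lambda>i. 2 * i + 2" "\<lambda>f. f div 2 - 1"])
      (auto elim!: evenE oddE simp: algebra_simps)
qed

lemma count_jacobi_231_odd:
  "count_jacobi_231 (2 * n + 1) = (\<Sum>i=0..n. count_jacobi_231 (2 * i) * count_jacobi_231 (2 * (n - i)))"
  using count_jacobi_231_rec[of "2 * n + 1"]
    sum_same_parity_odd[of "\<lambda>f j. count_jacobi_231 (f - 1) * count_jacobi_231 j" n]
  by simp

lemma count_jacobi_231_even:
  "count_jacobi_231 (2 * n + 2) = (\<Sum>i=0..n. count_jacobi_231 (2 * i + 1) * count_jacobi_231 (2 * (n - i)))"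
  using count_jacobi_231_rec[of "2 * n + 2"]
    sum_same_parity_even[of "\<lambda>f j. count_jacobi_231 (f - 1) * count_jacobi_231 j" n]
  by simp

lemma last_poly_odd:
  "last_poly (2 * n + 1) = (if n = 0 then monom 1 1 else 0) + last_poly (2 * n) +
    (\<Sum>i=0..n. monom (count_jacobi_231 (2 * i)) (2 * i + 1) * last_poly (2 * (n - i)))"
  using last_poly_rec[of "2 * n + 1"]
    sum_same_parity_odd[of "\<lambda>f j. monom (count_jacobi_231 (f - 1)) f * last_poly j" n]
  by simp

lemma last_poly_even:
  "last_poly (2 * n + 2) = last_poly (2 * n + 1) +
    (\<Sum>i=0..n. monom (count_jacobi_231 (2 * i + 1)) (2 * i + 2) * last_poly (2 * (n - i)))"
  using last_poly_rec[of "2 * n + 2"]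
    sum_same_parity_even[of "\<lambda>f j. monom (count_jacobi_231 (f - 1)) f * last_poly j" n]
  by simp

section \<open>Generating functions\<close>

unbundle fps_syntax

text \<open>With \<open>fps_X\<close> as \<open>x\<close> and \<open>monom 1 1\<close> as
  \<open>t\<close>, the exponent \<open>2 * n\<close> amounts to evaluation at
  \<open>x * t ^ 2\<close>. This suits the powers \<open>monom _ f\<close> in the recurrence for
  \<open>last_poly\<close>.\<close>

definition even_fps :: "real poly fps" where
  "even_fps = Abs_fps (\<lambda>n. monom (count_jacobi_231 (2 * n)) (2 * n))"

definition last_even_fps :: "real poly fps" where
  "last_even_fps = Abs_fps (\<lambda>n. last_poly (2 * n))"

definition last_odd_fps :: "real poly fps" where
  "last_odd_fps = Abs_fps (\<lambda>n. last_poly (2 * n + 1))"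

lemma monom_sum: "monom (\<Sum>i\<in>A. f i) n = (\<Sum>i\<in>A. monom (f i) n)"
  by (rule poly_eqI) (simp add: coeff_sum)

text \<open>In a word of odd length both factors have even length.\<close>

lemma even_fps_square:
  "even_fps ^ 2 = Abs_fps (\<lambda>n. monom (count_jacobi_231 (2 * n + 1)) (2 * n))"
proof (rule fps_ext)
  fix n
  have "(even_fps ^ 2) $ n = (\<Sum>i=0..n. monom (count_jacobi_231 (2 * i) * count_jacobi_231 (2 * (n - i))) (2 * n))"
    unfolding power2_eq_square fps_mult_nth
    by (intro sum.cong) (auto simp: even_fps_def mult_monom simp flip: distrib_left)
  then show "(even_fps ^ 2) $ n = Abs_fps (\<lambda>n. monom (count_jacobi_231 (2 * n + 1)) (2 * n)) $ n"
    by (simp only: count_jacobi_231_odd monom_sum fps_nth_Abs_fps)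
qed

text \<open>In a nonempty word of even length, \<open>u\<close> has odd length and is counted by
  \<open>even_fps ^ 2\<close>, while \<open>v\<close> has even length and is counted by
  \<open>even_fps\<close>.\<close>

lemma even_fps_cubic: "even_fps = 1 + fps_X * fps_const (monom 1 2) * even_fps ^ 3"
proof (rule fps_ext)
  fix n
  show "even_fps $ n = (1 + fps_X * fps_const (monom 1 2) * even_fps ^ 3) $ n"
  proof (cases n)
    case 0
    then show ?thesis
      by (simp add: even_fps_def count_jacobi_231_0 mult.assoc)
  next
    case (Suc k)
    have "(even_fps ^ 3) $ k = (even_fps ^ 2 * even_fps) $ k"
      by (simp add: power3_eq_cube power2_eq_square)
    also have "\<dots> = (\<Sum>i=0..k. monom (count_jacobi_231 (2 * i + 1) * count_jacobi_231 (2 * (k - i))) (2 * k))"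
      unfolding even_fps_square fps_mult_nth
      by (intro sum.cong) (auto simp: even_fps_def mult_monom simp flip: distrib_left)
    also have "\<dots> = monom (count_jacobi_231 (2 * k + 2)) (2 * k)"
      by (simp only: count_jacobi_231_even monom_sum)
    finally show ?thesis using Suc
      by (simp add: even_fps_def mult.assoc mult_monom)
  qed
qed

text \<open>The summands belong to the one-letter word, to empty \<open>v\<close> with nonempty
  \<open>u\<close>, and to nonempty \<open>v\<close>.\<close>

lemma last_odd_fps_eq:
  "last_odd_fps = fps_const (monom 1 1) + last_even_fps
     + fps_const (monom 1 1) * even_fps * last_even_fps"
proof (rule fps_ext)
  fix n
  have "(fps_const (monom 1 1) * even_fps * last_even_fps) $ n =
      (\<Sum>i=0..n. monom (count_jacobi_231 (2 * i)) (2 * i + 1) * last_poly (2 * (n - i)))"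
    unfolding fps_mult_nth[of "_ * _"]
    by (intro sum.cong) (auto simp: even_fps_def last_even_fps_def mult_monom)
  then show "last_odd_fps $ n = (fps_const (monom 1 1) + last_even_fps
     + fps_const (monom 1 1) * even_fps * last_even_fps) $ n"
    by (simp only: last_odd_fps_def fps_add_nth fps_nth_Abs_fps last_poly_odd)
      (simp add: last_even_fps_def)
qed

lemma last_even_fps_eq:
  "last_even_fps = fps_X * last_odd_fps
     + fps_X * (fps_const (monom 1 2) * even_fps ^ 2 * last_even_fps)"
proof (rule fps_ext)
  fix n
  show "last_even_fps $ n = (fps_X * last_odd_fps
     + fps_X * (fps_const (monom 1 2) * even_fps ^ 2 * last_even_fps)) $ n"
  proof (cases n)
    case 0
    then show ?thesis by (simp add: last_even_fps_def last_poly_0)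
  next
    case (Suc k)
    have "(fps_const (monom 1 2) * even_fps ^ 2 * last_even_fps) $ k =
        (\<Sum>i=0..k. monom (count_jacobi_231 (2 * i + 1)) (2 * i + 2) * last_poly (2 * (k - i)))"
      unfolding fps_mult_nth[of "_ * _"]
      by (intro sum.cong) (auto simp: even_fps_square last_even_fps_def mult_monom)
    then show ?thesis using last_poly_even[of k] Suc
      by (simp add: last_even_fps_def last_odd_fps_def)
  qed
qed

lemma last_even_fps_eq_last_odd_fps: "last_even_fps = fps_X * even_fps * last_odd_fps"
proof -
  have "even_fps * last_even_fps =
      even_fps * (fps_X * last_odd_fps + fps_X * (fps_const (monom 1 2) * even_fps ^ 2 * last_even_fps))"
    using last_even_fps_eq by (rule arg_cong)
  also have "\<dots> = fps_X * even_fps * last_odd_fps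
      + (fps_X * fps_const (monom 1 2) * even_fps ^ 3) * last_even_fps"
    by (simp add: algebra_simps power2_eq_square power3_eq_cube)
  also have "fps_X * fps_const (monom 1 2) * even_fps ^ 3 = even_fps - 1"
    using even_fps_cubic by (metis add_diff_cancel_left')
  finally show ?thesis by (simp add: algebra_simps)
qed

lemma last_odd_fps_linear:
  "last_odd_fps = fps_const (monom 1 1)
     + fps_X * (even_fps * (1 + fps_const (monom 1 1) * even_fps)) * last_odd_fps"
proof -
  have "last_odd_fps = fps_const (monom 1 1) + (1 + fps_const (monom 1 1) * even_fps) * last_even_fps"
    by (subst last_odd_fps_eq) (simp add: algebra_simps)
  also have "(1 + fps_const (monom 1 1) * even_fps) * last_even_fps =
      fps_X * (even_fps * (1 + fps_const (monom 1 1) * even_fps)) * last_odd_fps"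
    by (subst last_even_fps_eq_last_odd_fps) (simp add: algebra_simps)
  finally show ?thesis .
qed

section \<open>Coefficient extraction and Raney numbers\<close>

text \<open>Iteration gives a geometric series with remainder \<open>(fps_X * U) ^ N * Q\<close>,
  which vanishes in degree \<open>n\<close> for \<open>N = n + 1\<close>. The factor
  \<open>V\<close> covers both \<open>Q\<close> and \<open>e * Q\<close>.\<close>

lemma fps_linear_solution_nth:
  fixes Q U V :: "'a :: comm_ring_1 fps"
  assumes "Q = fps_const c + fps_X * U * Q"
  shows "(V * Q) $ n = c * (\<Sum>m=0..n. (V * U ^ (n - m)) $ m)"
proof -
  have expand: "Q = fps_const c * (\<Sum>j<N. (fps_X * U) ^ j) + (fps_X * U) ^ N * Q" for N
  proof (induction N)
    case (Suc N)
    have "(fps_X * U) ^ N * Q = (fps_X * U) ^ N * (fps_const c + fps_X * U * Q)"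
      using assms by (rule arg_cong)
    with Suc show ?case by (simp add: algebra_simps)
  qed simp
  have "V * Q = V * (fps_const c * (\<Sum>j<Suc n. (fps_X * U) ^ j) + (fps_X * U) ^ Suc n * Q)"
    using expand by (rule arg_cong)
  also have "\<dots> = fps_const c * (\<Sum>j<Suc n. fps_X ^ j * (V * U ^ j)) + fps_X ^ Suc n * (V * U ^ Suc n * Q)"
    unfolding power_mult_distrib sum_distrib_left distrib_left by (simp only: mult_ac)
  finally have "(V * Q) $ n = c * (\<Sum>j<Suc n. (fps_X ^ j * (V * U ^ j)) $ n)"
    by (simp only: fps_add_nth fps_mult_left_const_nth fps_sum_nth fps_X_power_mult_nth) simp
  also have "(\<Sum>j<Suc n. (fps_X ^ j * (V * U ^ j)) $ n) = (\<Sum>j<Suc n. (V * U ^ j) $ (n - j))"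
    by (intro sum.cong) (auto simp: fps_X_power_mult_nth)
  also have "\<dots> = (\<Sum>m=0..n. (V * U ^ (n - m)) $ m)"
    by (rule sum.reindex_bij_witness[of _ "\<lambda>m. n - m" "\<lambda>j. n - j"]) auto
  finally show ?thesis .
qed

text \<open>The case \<open>m = 0\<close> is separated because the quotient is the junk value \<open>0 / 0 = 0\<close>
  at \<open>r = m = 0\<close>.\<close>

definition raney :: "nat \<Rightarrow> nat \<Rightarrow> real" where
  "raney r m = (if m = 0 then 1 else real r / real (3 * m + r) * real ((3 * m + r) choose m))"

text \<open>With \<open>N = 3 * m + 3 + r\<close> all three terms are rational multiples of
  \<open>N choose m\<close>, and the claim reduces to
  \<open>r * (N - m) + (r + 3) * (m + 1) = (r + 1) * N\<close>.\<close>

lemma raney_Suc: "raney (Suc r) (Suc m) = raney r (Suc m) + raney (r + 3) m"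
proof -
  define N where "N = 3 * m + 3 + r"
  define B where "B = real (N choose m)"
  have N: "real N = 3 * real m + 3 + real r" "N > 0" by (simp_all add: N_def)
  have absorb: "(real m + 1) * real (Suc N choose Suc m) = (real N + 1) * B"
    using arg_cong[OF Suc_times_binomial[of m N], of real] by (simp add: B_def algebra_simps)
  then have B1: "real (Suc N choose Suc m) = (real N + 1) / (real m + 1) * B"
    by (simp add: field_simps)
  have "real (N choose Suc m) = real (Suc N choose Suc m) - B" by (simp add: B_def)
  also have "\<dots> = (real N - real m) / (real m + 1) * B"
    unfolding B1 by (simp add: field_simps)
  finally have B2: "real (N choose Suc m) = (real N - real m) / (real m + 1) * B" .
  have e: "3 * Suc m + Suc r = Suc N" "3 * Suc m + r = N" "3 * m + (r + 3) = N"
    by (simp_all add: N_def)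
  have r1: "raney r (Suc m) = real r / real N * ((real N - real m) / (real m + 1) * B)"
    unfolding raney_def e B2 by simp
  \<comment> \<open>At \<open>m = 0\<close> the definition gives 1, and the formula agrees because
    then \<open>N = r + 3\<close> and \<open>B = 1\<close>.\<close>
  have r3: "raney (r + 3) m = real (r + 3) / real N * B"
    unfolding raney_def e B_def by (simp add: N_def)
  have "raney (Suc r) (Suc m) = (real r + 1) / (real N + 1) * ((real N + 1) / (real m + 1) * B)"
    unfolding raney_def e B1 by (simp add: algebra_simps)
  also have "\<dots> = (real r + 1) / (real m + 1) * B"
  proof -
    have "real N + 1 \<noteq> 0" by linarith
    then show ?thesis by simp
  qed
  also have "\<dots> = (real r * (real N - real m) / (real m + 1) + (real r + 3)) / real N * B"
  proof -
    have "(real r * (real N - real m) / (real m + 1) + (real r + 3)) = (real r + 1) * real N / (real m + 1)"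
      using N(1) by (simp add: field_simps)
    then show ?thesis using N(2) by simp
  qed
  also have "\<dots> = raney r (Suc m) + raney (r + 3) m"
    unfolding r1 r3 by (simp only: add_divide_distrib distrib_right distrib_left times_divide_eq_left
      times_divide_eq_right divide_divide_eq_left mult_ac of_nat_add of_nat_numeral)
  finally show ?thesis .
qed

text \<open>Multiplying the cubic equation by \<open>e ^ r\<close> gives the recurrence \<open>raney_Suc\<close> for the
  coefficients of the powers of \<open>e\<close>.\<close>

lemma even_fps_power_nth: "(even_fps ^ r) $ m = monom (raney r m) (2 * m)"
proof (induction m arbitrary: r)
  case 0
  show ?case by (simp add: raney_def even_fps_def count_jacobi_231_0 fps_power_zeroth)
next
  case (Suc m)
  \<comment> \<open>The inner induction is on the exponent; the outer hypothesis is needed at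
    \<open>r + 3\<close>, hence for arbitrary exponents.\<close>
  show ?case
  proof (induction r)
    case 0
    show ?case by (simp add: raney_def)
  next
    case (Suc r)
    have "even_fps ^ Suc r = even_fps ^ r * (1 + fps_X * fps_const (monom 1 2) * even_fps ^ 3)"
      using even_fps_cubic by (metis power_Suc2)
    also have "\<dots> = even_fps ^ r + fps_X * (fps_const (monom 1 2) * even_fps ^ (r + 3))"
      by (simp add: algebra_simps power_add)
    finally have "(even_fps ^ Suc r) $ Suc m = (even_fps ^ r) $ Suc m + monom 1 2 * (even_fps ^ (r + 3)) $ m"
      by simp
    also have "\<dots> = monom (raney r (Suc m)) (2 * Suc m) + monom 1 2 * monom (raney (r + 3) m) (2 * m)"
      unfolding Suc.IH \<open>\<And>r. (even_fps ^ r) $ m = _\<close> ..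
    also have "\<dots> = monom (raney (Suc r) (Suc m)) (2 * Suc m)"
      by (simp add: raney_Suc mult_monom add_monom)
    finally show ?case .
  qed
qed

text \<open>In the expansion of \<open>(1 + t * e) ^ j\<close> the \<open>i\<close>-th term
  contributes at \<open>t ^ (2 * m + 1 + i)\<close>, the leading factor \<open>t\<close> included,
  so \<open>t ^ k\<close> selects \<open>i = k - 2 * m - 1\<close>. If this is negative,
  \<open>nat\<close> returns 0 but the binomial vanishes.\<close>

lemma coeff_even_fps_mult_power_nth:
  "coeff (monom 1 1 * ((even_fps ^ s * (even_fps * (1 + fps_const (monom 1 1) * even_fps)) ^ j) $ m)) k =
    real (int_binomial (int j) (int k - 2 * int m - 1))
      * raney (s + j + nat (int k - 2 * int m - 1)) m"
proof -
  have "even_fps ^ s * (even_fps * (1 + fps_const (monom 1 1) * even_fps)) ^ j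
      = even_fps ^ (s + j) * (fps_const (monom 1 1) * even_fps + 1) ^ j"
    by (simp add: power_mult_distrib power_add add.commute mult_ac)
  also have "\<dots> = (\<Sum>i\<le>j. fps_const (monom (real (j choose i)) i) * even_fps ^ (s + j + i))"
    unfolding binomial_ring sum_distrib_left
  proof (rule sum.cong)
    fix i
    have "of_nat (j choose i) * (fps_const (monom 1 1)) ^ i = (fps_const (monom (real (j choose i)) i) :: real poly fps)"
      by (simp add: fps_const_power monom_power fps_of_nat[symmetric] of_nat_monom mult_monom)
    then have "even_fps ^ (s + j) * (of_nat (j choose i) * (fps_const (monom 1 1)) ^ i * even_fps ^ i)
       = fps_const (monom (real (j choose i)) i) * (even_fps ^ (s + j) * even_fps ^ i)"
      by (simp add: mult_ac)
    then show "even_fps ^ (s + j) * (of_nat (j choose i) * (fps_const (monom 1 1) * even_fps) ^ i * 1 ^ (j - i))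
       = fps_const (monom (real (j choose i)) i) * even_fps ^ (s + j + i)"
      by (simp add: power_mult_distrib power_add mult_ac)
  qed simp
  finally have "monom 1 1 * ((even_fps ^ s * (even_fps * (1 + fps_const (monom 1 1) * even_fps)) ^ j) $ m) =
      (\<Sum>i\<le>j. monom (real (j choose i) * raney (s + j + i) m) (2 * m + 1 + i))"
    by (simp add: fps_sum_nth even_fps_power_nth sum_distrib_left mult_monom add_ac)
  then have *: "coeff (monom 1 1 * ((even_fps ^ s * (even_fps * (1 + fps_const (monom 1 1) * even_fps)) ^ j) $ m)) k =
      (\<Sum>i\<le>j. if 2 * m + 1 + i = k then real (j choose i) * raney (s + j + i) m else 0)"
    by (simp add: coeff_sum)
  show ?thesis
  proof (cases "k \<ge> 2 * m + 1 \<and> k - (2 * m + 1) \<le> j")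
    case True
    define i where "i = k - (2 * m + 1)"
    have i: "int k - 2 * int m - 1 = int i" "i \<le> j" using True by (auto simp: i_def)
    have "2 * m + 1 + i' = k \<longleftrightarrow> i' = i" for i' using True by (auto simp: i_def)
    then have "(\<Sum>i\<le>j. if 2 * m + 1 + i = k then real (j choose i) * raney (s + j + i) m else 0)
        = real (j choose i) * raney (s + j + i) m"
      using i(2) by (simp add: sum.delta)
    then show ?thesis using * i by (simp add: int_binomial_def)
  next
    case False
    then have "(\<Sum>i\<le>j. if 2 * m + 1 + i = k then real (j choose i) * raney (s + j + i) m else 0) = 0"
      by (intro sum.neutral) auto
    moreover have "int_binomial (int j) (int k - 2 * int m - 1) = 0"
      using False by (auto simp: int_binomial_def)
    ultimately show ?thesis using * by simp
  qed
qed

section \<open>Explicit formulas\<close>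

lemma jlast_odd:
  "real (jlast [2,3,1] (2 * n + 1) k) =
    (\<Sum>m=0..n. real (int_binomial (int (n - m)) (int k - 2 * int m - 1))
       * raney (n - m + nat (int k - 2 * int m - 1)) m)"
proof -
  have "last_poly (2 * n + 1) = (even_fps ^ 0 * last_odd_fps) $ n" by (simp add: last_odd_fps_def)
  also have "\<dots> = (\<Sum>m=0..n. monom 1 1 *
      (even_fps ^ 0 * (even_fps * (1 + fps_const (monom 1 1) * even_fps)) ^ (n - m)) $ m)"
    unfolding fps_linear_solution_nth[OF last_odd_fps_linear] sum_distrib_left ..
  finally show ?thesis
    unfolding coeff_last_poly[symmetric] by (simp only: coeff_sum coeff_even_fps_mult_power_nth add_0)
qed

text \<open>In \<open>P = x * e * Q\<close> the factor \<open>x\<close> lowers the degree by one,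
  hence \<open>Suc n\<close>, and the factor \<open>e\<close> adds 1 to the first Raney
  argument.\<close>

lemma jlast_even:
  "real (jlast [2,3,1] (2 * Suc n) k) =
    (\<Sum>m=0..n. real (int_binomial (int (n - m)) (int k - 2 * int m - 1))
       * raney (1 + (n - m) + nat (int k - 2 * int m - 1)) m)"
proof -
  have "last_poly (2 * Suc n) = last_even_fps $ Suc n" by (simp add: last_even_fps_def)
  also have "\<dots> = (even_fps ^ 1 * last_odd_fps) $ n"
    by (subst last_even_fps_eq_last_odd_fps) (simp add: mult.assoc)
  also have "\<dots> = (\<Sum>m=0..n. monom 1 1 *
      (even_fps ^ 1 * (even_fps * (1 + fps_const (monom 1 1) * even_fps)) ^ (n - m)) $ m)"
    unfolding fps_linear_solution_nth[OF last_odd_fps_linear] sum_distrib_left ..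
  finally show ?thesis
    unfolding coeff_last_poly[symmetric] by (simp only: coeff_sum coeff_even_fps_mult_power_nth)
qed

text \<open>Here \<open>3 * m + r = n + k - 1\<close> is positive, so the quotient is a true 1 at
  \<open>m = 0\<close>, in accordance with the definition.\<close>

lemma raney_eq:
  fixes n k m r :: nat
  assumes "int r = int n + int k - 3 * int m - 1" "n \<ge> 1" "k \<ge> 1"
  shows "raney r m = (real n + real k - 3 * real m - 1) / (real n + real k - 1)
    * real (int_binomial (int n + int k - 1) (int m))"
proof -
  have s: "3 * m + r = n + k - 1" "int n + int k - 1 = int (n + k - 1)" using assms by linarith+
  have m: "m \<le> n + k - 1" using s(1) by linarith
  have "real r = real n + real k - 3 * real m - 1"
    using arg_cong[OF assms(1), of real_of_int] by simp
  moreover have "real (n + k - 1) = real n + real k - 1" using assms by simp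
  moreover have "int_binomial (int n + int k - 1) (int m) = (n + k - 1) choose m"
    unfolding s(2) int_binomial_def using m by simp
  moreover have "real n + real k - 1 > 0" using assms by simp
  ultimately show ?thesis unfolding raney_def s(1) by simp
qed

theorem theorem5p11:
  fixes n k :: nat
  assumes "n \<ge> 1" and "k \<ge> 1"
  shows "real (jlast [2,3,1] (2 * n) k) =
           (\<Sum>m = 0..n - 1. (real n + real k - 3 * real m - 1) / (real n + real k - 1)
              * real (int_binomial (int n - int m - 1) (int k - 2 * int m - 1))
              * real (int_binomial (int n + int k - 1) (int m)))
       \<and> real (jlast [2,3,1] (2 * n + 1) k) =
           (\<Sum>m = 0..n - 1. (real n + real k - 3 * real m - 1) / (real n + real k - 1)
              * real (int_binomial (int n - int m) (int k - 2 * int m - 1))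
              * real (int_binomial (int n + int k - 1) (int m)))"
proof
  obtain n' where n': "n = Suc n'" using assms(1) by (cases n) auto
  have summand: "real (int_binomial (int (n' - m)) (int k - 2 * int m - 1))
       * raney (1 + (n' - m) + nat (int k - 2 * int m - 1)) m =
      (real n + real k - 3 * real m - 1) / (real n + real k - 1)
              * real (int_binomial (int n - int m - 1) (int k - 2 * int m - 1))
              * real (int_binomial (int n + int k - 1) (int m))" if "m \<in> {0..n - 1}" for m
  \<comment> \<open>\<open>nat\<close> truncates only for \<open>k < 2 * m + 1\<close>, where both
    sides have a zero binomial; otherwise the first Raney argument is
    \<open>n + k - 3 * m - 1\<close>.\<close>
  proof (cases "int k - 2 * int m - 1 \<ge> 0")
    case True
    have "int (1 + (n' - m) + nat (int k - 2 * int m - 1)) = int n + int k - 3 * int m - 1"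
      using True that n' by auto
    moreover have "int (n' - m) = int n - int m - 1" using that n' by auto
    ultimately show ?thesis using raney_eq[OF _ assms] by (simp only: mult_ac)
  next
    case False
    then show ?thesis by (simp add: int_binomial_def)
  qed
  have "real (jlast [2,3,1] (2 * n) k) =
      (\<Sum>m=0..n - 1. real (int_binomial (int (n' - m)) (int k - 2 * int m - 1))
         * raney (1 + (n' - m) + nat (int k - 2 * int m - 1)) m)"
    unfolding n' jlast_even by (simp only: diff_Suc_1)
  also have "\<dots> = (\<Sum>m = 0..n - 1. (real n + real k - 3 * real m - 1) / (real n + real k - 1)
              * real (int_binomial (int n - int m - 1) (int k - 2 * int m - 1))
              * real (int_binomial (int n + int k - 1) (int m)))"
    using summand by (rule sum.cong[OF refl])
  finally show "real (jlast [2,3,1] (2 * n) k) =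
           (\<Sum>m = 0..n - 1. (real n + real k - 3 * real m - 1) / (real n + real k - 1)
              * real (int_binomial (int n - int m - 1) (int k - 2 * int m - 1))
              * real (int_binomial (int n + int k - 1) (int m)))" .
next
  let ?t = "\<lambda>m. real (int_binomial (int (n - m)) (int k - 2 * int m - 1))
       * raney (n - m + nat (int k - 2 * int m - 1)) m"
  \<comment> \<open>The sum from \<open>jlast_odd\<close> has one term more than claimed. At
    \<open>m = n\<close> the binomial is nonzero only for \<open>k = 2 * n + 1\<close>, and then the
    factor is \<open>raney 0 n\<close>, which is 0 because \<open>n\<close> is positive.\<close>
  have "?t n = 0"
    using assms(1) by (auto simp: int_binomial_def raney_def)
  then have "real (jlast [2,3,1] (2 * n + 1) k) = (\<Sum>m=0..n - 1. ?t m)"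
    unfolding jlast_odd using assms(1) by (cases n) simp_all
  also have "\<dots> = (\<Sum>m = 0..n - 1. (real n + real k - 3 * real m - 1) / (real n + real k - 1)
              * real (int_binomial (int n - int m) (int k - 2 * int m - 1))
              * real (int_binomial (int n + int k - 1) (int m)))"
  proof (rule sum.cong)
    fix m assume m: "m \<in> {0..n - 1}"
    show "?t m = (real n + real k - 3 * real m - 1) / (real n + real k - 1)
              * real (int_binomial (int n - int m) (int k - 2 * int m - 1))
              * real (int_binomial (int n + int k - 1) (int m))"
    proof (cases "int k - 2 * int m - 1 \<ge> 0")
      case True
      have "int (n - m + nat (int k - 2 * int m - 1)) = int n + int k - 3 * int m - 1"
        using True m by auto
      moreover have "int (n - m) = int n - int m" using m by auto
      ultimately show ?thesis using raney_eq[OF _ assms] by (simp only: mult_ac)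
    next
      case False
      then show ?thesis by (simp add: int_binomial_def)
    qed
  qed simp
  finally show "real (jlast [2,3,1] (2 * n + 1) k) =
           (\<Sum>m = 0..n - 1. (real n + real k - 3 * real m - 1) / (real n + real k - 1)
              * real (int_binomial (int n - int m) (int k - 2 * int m - 1))
              * real (int_binomial (int n + int k - 1) (int m)))" .
qed

end
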